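(* Let $V$ be a Banach space, $\ell_1,\dots,\ell_m\in V'$ linearly independent continuous linear functionals, $\ell=(\ell_1,\dots,\ell_m):V\to\mathbb{R}^m$, $V_n\subset V$ a (possibly nonlinear) approximation space, and $1\le p\le\infty$. For any norm $\|\cdot\|_Z$ on $\mathbb{R}^m$, one has $$\alpha_W\mu_W=\mu_W\le\alpha_Z\mu_Z\qquad\text{and}\qquad \beta_p\mu_p=\mu_p\le\beta_Z\mu_Z,$$ where $(\alpha_W,\beta_W,\mu_W)$ and $(\alpha_p,\beta_p,\mu_p)$ denote the triplets $(\alpha_Z,\beta_Z,\mu_Z)$ obtained when $\|\cdot\|_Z$ is taken to be the Riesz norm $\|\cdot\|_W$ and the $\ell^p$ norm $\|\cdot\|_p$, respectively.
   Context: The approximation space is of the form $V_n=\{\varphi(x):x\in S\}$ for some set $S\subset\mathbb{R}^n$ and some continuous map $\varphi:S\to V$. Put $V_n^{\mathrm{diff}}=V_n-V_n:=\{v_1-v_2: v_1,v_2\in V_n\}$. For a norm $\|\cdot\|_Z$ on $\mathbb{R}^m$ define $$\alpha_Z=\sup_{v\in V\setminus\{0\}}\frac{\|\ell(v)\|_Z}{\|v\|_V},\qquad \mu_Z=\sup_{v\in V_n^{\mathrm{diff}}\setminus\{0\}}\frac{\|v\|_V}{\|\ell(v)\|_Z},\qquad \beta_Z=\max_{z\in\mathbb{R}^m\setminus\{0\}}\frac{\|z\|_Z}{\|z\|_p}.$$ It is a standing assumption that the inverse stability property holds, i.e. $\mu_Z<\infty$ (this does not depend on the choice of norm on $\mathbb{R}^m$).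 The Riesz norm on $\mathbb{R}^m$ is $\|z\|_W:=\inf\{\|v\|_V : v\in V,\ \ell(v)=z\}$. *)

theory Defs
  imports "HOL-Analysis.Analysis"
begin

definition is_norm :: "('a::real_vector \<Rightarrow> real) \<Rightarrow> bool" where
  "is_norm N \<longleftrightarrow>
     (\<forall>x. 0 \<le> N x) \<and>
     (\<forall>x. N x = 0 \<longleftrightarrow> x = 0) \<and>
     (\<forall>c x. N (c *\<^sub>R x) = \<bar>c\<bar> * N x) \<and>
     (\<forall>x y. N (x + y) \<le> N x + N y)"

text \<open>For \<open>p = \<infinity>\<close> this is the maximum norm, which the library calls \<^const>\<open>infnorm\<close>.\<close>

definition lp_norm :: "ereal \<Rightarrow> real ^ 'm \<Rightarrow> real" where
  "lp_norm p z =
     (if p = \<infinity> then infnorm z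
      else (\<Sum>i\<in>UNIV. \<bar>z $ i\<bar> powr real_of_ereal p) powr (1 / real_of_ereal p))"

definition measurement :: "('m::finite \<Rightarrow> 'v::real_normed_vector \<Rightarrow>\<^sub>L real) \<Rightarrow> 'v \<Rightarrow> real ^ 'm" where
  "measurement l v = (\<chi> i. blinfun_apply (l i) v)"

definition riesz_norm :: "('m::finite \<Rightarrow> 'v::real_normed_vector \<Rightarrow>\<^sub>L real) \<Rightarrow> real ^ 'm \<Rightarrow> real" where
  "riesz_norm l z = Inf {norm v | v. measurement l v = z}"

definition diff_set :: "'v::ab_group_add set \<Rightarrow> 'v set" where
  "diff_set A = {v1 - v2 | v1 v2. v1 \<in> A \<and> v2 \<in> A}"

text \<open>
  The three constants take values in \<open>[0, \<infinity>]\<close>, so that no supremum has to be assumed finite.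
  In particular, if some nonzero \<open>v\<close> in the difference set has \<open>measurement l v = 0\<close>, then the
  corresponding quotient is \<open>\<infinity>\<close>, because \<open>x / 0 = \<infinity>\<close> for \<open>x > 0\<close> in \<^typ>\<open>ennreal\<close>.
  If the difference set is \<open>{0}\<close> or empty, the supremum over the empty set is \<open>0\<close>.
\<close>

definition alpha :: "('m::finite \<Rightarrow> 'v::real_normed_vector \<Rightarrow>\<^sub>L real) \<Rightarrow> (real ^ 'm \<Rightarrow> real) \<Rightarrow> ennreal" where
  "alpha l Z = (SUP v\<in>UNIV - {0}. ennreal (Z (measurement l v)) / ennreal (norm v))"

definition mu ::
  "('m::finite \<Rightarrow> 'v::real_normed_vector \<Rightarrow>\<^sub>L real) \<Rightarrow> 'v set \<Rightarrow> (real ^ 'm \<Rightarrow> real) \<Rightarrow> ennreal" where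
  "mu l A Z = (SUP v\<in>diff_set A - {0}. ennreal (norm v) / ennreal (Z (measurement l v)))"

text \<open>The supremum is a maximum when \<open>Z\<close> is a norm and \<open>p \<ge> 1\<close>: see \<open>beta_attained\<close> below.\<close>

definition beta :: "ereal \<Rightarrow> (real ^ 'm \<Rightarrow> real) \<Rightarrow> ennreal" where
  "beta p Z = (SUP z\<in>UNIV - {0}. ennreal (Z z) / ennreal (lp_norm p z))"

text \<open>
  Finiteness of \<^const>\<open>mu\<close> does not depend on the norm, since all norms on \<open>\<real>\<^sup>m\<close> are equivalent.
\<close>

definition inverse_stable :: "('m::finite \<Rightarrow> 'v::real_normed_vector \<Rightarrow>\<^sub>L real) \<Rightarrow> 'v set \<Rightarrow> bool" where
  "inverse_stable l A \<longleftrightarrow> (\<exists>Z. is_norm Z \<and> mu l A Z < \<infinity>)"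

lemma continuous_on_is_norm:
  fixes Z :: "real ^ 'm \<Rightarrow> real"
  assumes "is_norm Z"
  shows "continuous_on A Z"
proof -
  have "convex_on UNIV Z"
  proof (rule convex_onI)
    fix t :: real and x y :: "real ^ 'm"
    assume t: "0 < t" "t < 1"
    have "Z ((1 - t) *\<^sub>R x + t *\<^sub>R y) \<le> Z ((1 - t) *\<^sub>R x) + Z (t *\<^sub>R y)"
      using assms unfolding is_norm_def by blast
    also have "\<dots> = \<bar>1 - t\<bar> * Z x + \<bar>t\<bar> * Z y"
      using assms unfolding is_norm_def by metis
    finally show "Z ((1 - t) *\<^sub>R x + t *\<^sub>R y) \<le> (1 - t) * Z x + t * Z y"
      using t by simp
  qed simp
  then have "continuous_on UNIV Z"
    by (intro convex_on_continuous) auto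
  then show ?thesis
    by (rule continuous_on_subset) simp
qed

lemma lp_norm_pos:
  assumes "1 \<le> p" "z \<noteq> 0"
  shows "0 < lp_norm p z"
proof (cases "p = \<infinity>")
  case True
  then show ?thesis using assms by (simp add: lp_norm_def infnorm_pos_lt)
next
  case False
  obtain i where i: "z $ i \<noteq> 0"
    using assms by (auto simp: vec_eq_iff)
  have "0 < (\<Sum>i\<in>UNIV. \<bar>z $ i\<bar> powr real_of_ereal p)"
    by (rule sum_pos2[of _ i]) (use i in auto)
  with False show ?thesis by (simp add: lp_norm_def)
qed

lemma lp_norm_scaleR:
  assumes "1 \<le> p"
  shows "lp_norm p (c *\<^sub>R z) = \<bar>c\<bar> * lp_norm p z"
proof (cases "p = \<infinity>")
  case True
  then show ?thesis by (simp add: lp_norm_def infnorm_mul)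
next
  case False
  then have p: "real_of_ereal p > 0" using assms by (cases p) auto
  have "(\<Sum>i\<in>UNIV. \<bar>(c *\<^sub>R z) $ i\<bar> powr real_of_ereal p)
      = \<bar>c\<bar> powr real_of_ereal p * (\<Sum>i\<in>UNIV. \<bar>z $ i\<bar> powr real_of_ereal p)"
    by (simp add: abs_mult powr_mult sum_distrib_left)
  with False p show ?thesis
    by (simp add: lp_norm_def powr_mult powr_powr sum_nonneg)
qed

lemma continuous_on_lp_norm:
  assumes "1 \<le> p"
  shows "continuous_on A (lp_norm p :: real ^ 'm \<Rightarrow> real)"
proof (cases "p = \<infinity>")
  case True
  then have "lp_norm p = (infnorm :: real ^ 'm \<Rightarrow> real)"
    by (auto simp: lp_norm_def)
  then show ?thesis
    by (simp add: continuous_on_def tendsto_infnorm)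
next
  case False
  then have p: "real_of_ereal p > 0" using assms by (cases p) auto
  from False have "lp_norm p =
      (\<lambda>z :: real ^ 'm. (\<Sum>i\<in>UNIV. \<bar>z $ i\<bar> powr real_of_ereal p) powr (1 / real_of_ereal p))"
    by (auto simp: lp_norm_def)
  then show ?thesis
    using p by (auto intro!: continuous_intros continuous_on_powr' sum_nonneg)
qed

lemma beta_attained:
  fixes Z :: "real ^ 'm \<Rightarrow> real"
  assumes "is_norm Z" "1 \<le> p"
  shows "\<exists>z\<in>UNIV - {0}. beta p Z = ennreal (Z z) / ennreal (lp_norm p z)"
proof -
  let ?q = "\<lambda>z. Z z / lp_norm p z"
  have "continuous_on (sphere 0 1) ?q"
  proof (intro continuous_on_divide ballI)
    show "continuous_on (sphere 0 1) Z"
      by (rule continuous_on_is_norm[OF assms(1)])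
    show "continuous_on (sphere 0 1) (lp_norm p :: real ^ 'm \<Rightarrow> real)"
      by (rule continuous_on_lp_norm[OF assms(2)])
    show "lp_norm p z \<noteq> 0" if "z \<in> sphere 0 1" for z :: "real ^ 'm"
      using lp_norm_pos[OF assms(2), of z] that by (cases "z = 0") auto
  qed
  moreover have "sphere (0 :: real ^ 'm) 1 \<noteq> {}"
    by simp
  ultimately obtain z0 where z0: "z0 \<in> sphere 0 1" and max: "\<And>z. z \<in> sphere 0 1 \<Longrightarrow> ?q z \<le> ?q z0"
    using continuous_attains_sup[of "sphere 0 1" ?q] compact_sphere by metis
  from z0 have "z0 \<noteq> 0" by auto
  have q: "ennreal (Z z) / ennreal (lp_norm p z) = ennreal (?q z)" if "z \<noteq> 0" for z
    using lp_norm_pos[OF assms(2) that] assms(1) by (simp add: is_norm_def divide_ennreal)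
  have "?q z \<le> ?q z0" if "z \<noteq> 0" for z
  proof -
    have "?q z = ?q ((1 / norm z) *\<^sub>R z)"
      using that assms by (simp add: lp_norm_scaleR is_norm_def)
    also have "\<dots> \<le> ?q z0"
      using that by (intro max) simp
    finally show ?thesis .
  qed
  then have "beta p Z = ennreal (?q z0)"
    unfolding beta_def using q \<open>z0 \<noteq> 0\<close>
    by (intro antisym SUP_least SUP_upper2[of z0]) (auto intro: ennreal_leI)
  then show ?thesis
    using q \<open>z0 \<noteq> 0\<close> by auto
qed

end

theory Submission
  imports Defs
begin

text \<open>
  Both inequalities are a change of norm. If \<open>Z z \<le> c * N z\<close> for every \<open>z\<close> in the range of the
  measurement map, then \<open>norm v / N (\<ell> v) \<le> c * (norm v / Z (\<ell> v))\<close> for every \<open>v\<close>, and hence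
  \<open>\<mu>\<^sub>N \<le> c * \<mu>\<^sub>Z\<close> (\<open>mu_le_mult_mu\<close>).

  For \<open>N\<close> the \<open>\<ell>\<^sup>p\<close> norm, the best such \<open>c\<close> is \<open>\<beta>\<^sub>Z\<close> by definition. For \<open>N\<close> the Riesz norm \<open>W\<close>, the
  constant \<open>\<alpha>\<^sub>Z\<close> works: \<open>Z z \<le> \<alpha>\<^sub>Z * norm w\<close> holds for every preimage \<open>w\<close> of \<open>z\<close>, so one may pass
  to the infimum over these preimages, which is \<open>W z\<close> (\<open>norm_le_alpha_mult_riesz_norm\<close>). In
  other words \<open>\<alpha>\<^sub>Z\<close> is the operator norm of \<open>\<ell>\<close> from \<open>V\<close> to \<open>(\<real>\<^sup>m, Z)\<close> and \<open>W\<close> is the quotient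
  norm of \<open>V\<close> by the kernel of \<open>\<ell>\<close>.

  It remains to see that \<open>\<alpha>\<^sub>W = 1\<close> and \<open>\<beta>\<^sub>p = 1\<close>. The latter is a supremum of quotients \<open>x / x\<close>. For
  the former, \<open>W (\<ell> v) \<le> norm v\<close> gives \<open>\<alpha>\<^sub>W \<le> 1\<close>, and the bound \<open>Z z \<le> \<alpha>\<^sub>Z * W z\<close> for \<open>Z = W\<close> gives
  \<open>1 \<le> \<alpha>\<^sub>W\<close> as soon as \<open>W z > 0\<close> for some \<open>z\<close> in the range; linear independence provides such
  a \<open>z\<close>, and continuity of the functionals makes \<open>W\<close> positive there.
\<close>

lemma le_mult_if_divide_le_ennreal:
  fixes x y c :: ennreal
  assumes "x / y \<le> c" "y \<noteq> 0" "y \<noteq> top"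
  shows "x \<le> c * y"
proof -
  have "x = x / y * y"
    using assms by (simp add: ennreal_divide_times ennreal_times_divide mult_divide_eq_ennreal)
  also have "\<dots> \<le> c * y"
    using assms by (intro mult_right_mono) auto
  finally show ?thesis .
qed

lemma riesz_norm_le:
  "riesz_norm l (measurement l v) \<le> norm v"
  unfolding riesz_norm_def by (rule cInf_lower) (auto intro: bdd_belowI[of _ 0])

lemma riesz_norm_greatest:
  assumes "\<And>w. measurement l w = measurement l v \<Longrightarrow> c \<le> norm w"
  shows "c \<le> riesz_norm l (measurement l v)"
  unfolding riesz_norm_def by (rule cInf_greatest) (use assms in auto)

lemma riesz_norm_zero: "riesz_norm l 0 = 0"
proof -
  have "measurement l 0 = 0"
    by (simp add: measurement_def vec_eq_iff)
  then show ?thesis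
    using riesz_norm_le[of l 0] riesz_norm_greatest[of l 0 0] by simp
qed

text \<open>
  A fixed nonzero value of a continuous functional cannot be attained by arbitrarily small
  vectors.
\<close>

lemma riesz_norm_pos:
  assumes "measurement l v \<noteq> 0"
  shows "0 < riesz_norm l (measurement l v)"
proof -
  obtain i where i: "l i v \<noteq> 0"
    using assms by (auto simp: measurement_def vec_eq_iff)
  then have "norm (l i) > 0"
    by auto
  have "\<bar>l i v\<bar> / norm (l i) \<le> norm w" if "measurement l w = measurement l v" for w
  proof -
    have "l i w = l i v"
      using that by (simp add: measurement_def vec_eq_iff)
    then have "\<bar>l i v\<bar> \<le> norm (l i) * norm w"
      using norm_blinfun[of "l i" w] by simp
    then show ?thesis
      using \<open>norm (l i) > 0\<close> by (simp add: divide_le_eq mult.commute)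
  qed
  then have "\<bar>l i v\<bar> / norm (l i) \<le> riesz_norm l (measurement l v)"
    by (rule riesz_norm_greatest)
  moreover have "0 < \<bar>l i v\<bar> / norm (l i)"
    using i \<open>norm (l i) > 0\<close> by simp
  ultimately show ?thesis
    by linarith
qed

text \<open>
  The bound \<open>Z (\<ell> w) \<le> \<alpha>\<^sub>Z * norm w\<close> has the same left-hand side for all \<open>w\<close> with the same
  measurements, so the infimum over \<open>w\<close> may be taken on the right. The lemma is stated for
  any \<open>Z\<close> with \<open>Z 0 = 0\<close> because it is also used with \<open>Z\<close> the Riesz norm, where it yields
  \<open>\<alpha>\<^sub>W \<ge> 1\<close>.
\<close>

lemma norm_le_alpha_mult_riesz_norm:
  assumes "Z 0 = 0"
  shows "ennreal (Z (measurement l v)) \<le> alpha l Z * ennreal (riesz_norm l (measurement l v))"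
proof (cases "measurement l v = 0")
  case True
  then show ?thesis
    using assms by simp
next
  case False
  let ?z = "measurement l v"
  note pos = riesz_norm_pos[OF False]
  show ?thesis
  proof (cases "alpha l Z")
    case top
    with pos show ?thesis
      by (simp add: ennreal_top_mult)
  next
    case (real a)
    have le: "Z ?z \<le> a * norm w" if w: "measurement l w = ?z" for w
    proof -
      have "w \<noteq> 0"
        using w False by (auto simp: measurement_def vec_eq_iff)
      then have "ennreal (Z (measurement l w)) / ennreal (norm w) \<le> alpha l Z"
        unfolding alpha_def by (intro SUP_upper) auto
      then have "ennreal (Z ?z) \<le> ennreal a * ennreal (norm w)"
        using \<open>w \<noteq> 0\<close> by (intro le_mult_if_divide_le_ennreal) (simp_all add: w real)
      then show ?thesis
        using real by (simp flip: ennreal_mult)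
    qed
    have "Z ?z \<le> a * riesz_norm l ?z"
    proof (cases "a = 0")
      case True
      then show ?thesis
        using le[of v] by simp
    next
      case a: False
      then have "a > 0"
        using real by simp
      then have "Z ?z / a \<le> riesz_norm l ?z"
        by (intro riesz_norm_greatest) (use le in \<open>auto simp: divide_le_eq mult.commute\<close>)
      then show ?thesis
        using \<open>a > 0\<close> by (simp add: divide_le_eq mult.commute)
    qed
    then show ?thesis
      using real pos by (simp flip: ennreal_mult)
  qed
qed

lemma alpha_riesz_norm:
  fixes l :: "'m::finite \<Rightarrow> 'v::real_normed_vector \<Rightarrow>\<^sub>L real"
  assumes "measurement l v \<noteq> 0"
  shows "alpha l (riesz_norm l) = 1"
proof (rule antisym)
  show "alpha l (riesz_norm l) \<le> 1"
    unfolding alpha_def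
  proof (rule SUP_least)
    fix w :: 'v
    assume "w \<in> UNIV - {0}"
    then show "ennreal (riesz_norm l (measurement l w)) / ennreal (norm w) \<le> 1"
      using riesz_norm_le[of l w]
      by (intro divide_le_posI_ennreal) (auto intro: ennreal_leI)
  qed
next
  let ?r = "riesz_norm l (measurement l v)"
  have "1 * ennreal ?r \<le> alpha l (riesz_norm l) * ennreal ?r"
    using norm_le_alpha_mult_riesz_norm[where Z = "riesz_norm l" and l = l and v = v, OF riesz_norm_zero] by simp
  then show "1 \<le> alpha l (riesz_norm l)"
    using riesz_norm_pos[OF assms]
    by (subst (asm) (1 2) mult.commute, subst (asm) ennreal_mult_le_mult_iff) auto
qed

lemma beta_lp_norm:
  assumes "1 \<le> p"
  shows "beta p (lp_norm p :: real ^ 'm \<Rightarrow> real) = 1"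
proof -
  obtain z :: "real ^ 'm" where "z \<noteq> 0"
    using zero_neq_one by metis
  then have "UNIV - {0 :: real ^ 'm} \<noteq> {}"
    by auto
  moreover have "ennreal (lp_norm p y) / ennreal (lp_norm p y) = 1"
    if "y \<in> UNIV - {0}" for y :: "real ^ 'm"
    using lp_norm_pos[OF assms, of y] that by (simp add: divide_ennreal)
  ultimately show ?thesis
    unfolding beta_def by (simp only: SUP_const simp_thms cong: SUP_cong)
qed

lemma norm_le_beta_mult_lp_norm:
  fixes z :: "real ^ 'm"
  assumes "1 \<le> p" "Z 0 = 0"
  shows "ennreal (Z z) \<le> beta p Z * ennreal (lp_norm p z)"
proof (cases "z = 0")
  case True
  then show ?thesis
    using assms by simp
next
  case False
  then have "ennreal (Z z) / ennreal (lp_norm p z) \<le> beta p Z"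
    unfolding beta_def by (intro SUP_upper) auto
  then show ?thesis
    using lp_norm_pos[OF assms(1) False] by (intro le_mult_if_divide_le_ennreal) simp_all
qed

text \<open>
  The condition \<open>c \<noteq> 0\<close> is there for a nonzero \<open>v\<close> in the difference set whose measurements
  vanish: the quotient defining \<open>\<mu>\<close> is then infinite for every norm, and \<open>0 * \<infinity> = 0\<close> in
  \<^typ>\<open>ennreal\<close>.
\<close>

lemma mu_le_mult_mu:
  assumes le: "\<And>v. ennreal (Z (measurement l v)) \<le> c * ennreal (N (measurement l v))"
    and "c \<noteq> 0"
  shows "mu l A N \<le> c * mu l A Z"
  unfolding mu_def[of l A N]
proof (rule SUP_least)
  fix v assume v: "v \<in> diff_set A - {0}"
  let ?a = "ennreal (norm v)" and ?N = "ennreal (N (measurement l v))"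
    and ?Z = "ennreal (Z (measurement l v))"
  have "?a / ?N \<le> c * (?a / ?Z)"
  proof (cases "?Z = 0")
    case True
    then have "?a / ?Z = \<infinity>"
      using v by simp
    with \<open>c \<noteq> 0\<close> show ?thesis
      by (simp add: ennreal_mult_top)
  next
    case False
    \<comment> \<open>Then \<open>?N\<close> is nonzero as well, and \<open>?a / ?N = (?Z / ?N) * (?a / ?Z)\<close>.\<close>
    then have "?N \<noteq> 0"
      using le[of v] by auto
    have "?a / ?N = (?Z / ?N) * (?a / ?Z)"
      using False by (simp add: ennreal_divide_times ennreal_times_divide mult_divide_eq_ennreal mult.commute)
    also have "?Z / ?N \<le> c"
      using le[of v] \<open>?N \<noteq> 0\<close> by (intro divide_le_posI_ennreal) (auto simp: mult.commute zero_less_iff_neq_zero)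
    finally show ?thesis
      by (simp add: mult_right_mono)
  qed
  also have "\<dots> \<le> c * mu l A Z"
    unfolding mu_def using v by (intro mult_left_mono SUP_upper) auto
  finally show "?a / ?N \<le> c * mu l A Z" .
qed

theorem theorem3p2:
  fixes l :: "'m::finite \<Rightarrow> 'v::banach \<Rightarrow>\<^sub>L real"
    and S :: "(real ^ 'n) set"
    and \<phi> :: "real ^ 'n \<Rightarrow> 'v"
    and Vn :: "'v set"
    and p :: ereal
    and Z :: "real ^ 'm \<Rightarrow> real"
  assumes "inj l" and "independent (range l)"
    and "continuous_on S \<phi>" and "Vn = \<phi> ` S"
    and "inverse_stable l Vn"
    and "1 \<le> p"
    and "is_norm Z"
  shows "alpha l (riesz_norm l) * mu l Vn (riesz_norm l) = mu l Vn (riesz_norm l)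
    \<and> mu l Vn (riesz_norm l) \<le> alpha l Z * mu l Vn Z
    \<and> beta p (lp_norm p) * mu l Vn (lp_norm p) = mu l Vn (lp_norm p)
    \<and> mu l Vn (lp_norm p) \<le> beta p Z * mu l Vn Z"
proof -
  have Z0: "Z 0 = 0" and Zpos: "\<And>z. z \<noteq> 0 \<Longrightarrow> Z z > 0"
    using \<open>is_norm Z\<close> by (auto simp: is_norm_def less_le)
  obtain i :: 'm where True
    by simp
  have "l i \<noteq> 0"
    using \<open>independent (range l)\<close> dependent_zero by (metis rangeI)
  then obtain v where "l i v \<noteq> 0"
    by (metis blinfun_eqI zero_blinfun.rep_eq)
  then have v: "measurement l v \<noteq> 0"
    by (auto simp: measurement_def vec_eq_iff)
  \<comment> \<open>Neither constant vanishes, since \<open>Z\<close> is positive at the nonzero measurement \<open>\<ell> v\<close>.\<close>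
  have "alpha l Z \<noteq> 0"
    using norm_le_alpha_mult_riesz_norm[where Z = Z, OF Z0, of l v] Zpos[OF v]
    by auto
  then have W: "mu l Vn (riesz_norm l) \<le> alpha l Z * mu l Vn Z"
    by (intro mu_le_mult_mu norm_le_alpha_mult_riesz_norm[where Z = Z, OF Z0])
  have "beta p Z \<noteq> 0"
    using norm_le_beta_mult_lp_norm[where Z = Z, OF \<open>1 \<le> p\<close> Z0, of "measurement l v"] Zpos[OF v]
    by auto
  then have P: "mu l Vn (lp_norm p) \<le> beta p Z * mu l Vn Z"
    by (intro mu_le_mult_mu norm_le_beta_mult_lp_norm[where Z = Z, OF \<open>1 \<le> p\<close> Z0])
  show ?thesis
    using W P by (simp add: alpha_riesz_norm[OF v] beta_lp_norm[OF \<open>1 \<le> p\<close>])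
qed

end
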